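(* Let $b=\langle b(n):n<\omega\rangle$ be a sequence of non-empty sets and $h\in\omega^\omega$ with $0<h(n)<|b(n)|$ for all $n<\omega$, and set $\frac{h(n)}{|b(n)|}:=0$ whenever $b(n)$ is infinite. If the sequence $\langle\frac{h(n)}{|b(n)|}:n<\omega\rangle$ does not converge to $0$, then $\mathfrak{b}^{\mathrm{aLc}}_{b,h}=N$, where $N$ is the least natural number such that $B_N:=\{n<\omega:|b(n)|\leq N\cdot h(n)\}$ is infinite, and $\mathfrak{d}^{\mathrm{aLc}}_{b,h}=\mathfrak{c}$.
   Context: For a sequence $b$ of non-empty sets and $h\in\omega^\omega$, let $\prod b=\prod_{n<\omega}b(n)$ and $\mathcal{S}(b,h)=\prod_{n<\omega}[b(n)]^{\leq h(n)}$. Say that $\varphi\in\mathcal{S}(b,h)$ anti-localizes $y\in\prod b$ if $y(n)\notin\varphi(n)$ for all but finitely many $n$. The anti-localization cardinals are: $\mathfrak{b}^{\mathrm{aLc}}_{b,h}$ = the least size of a set $F\subseteq\mathcal{S}(b,h)$ such that there is no $y\in\prod b$ anti-localized by every $\varphi\in F$; $\mathfrak{d}^{\mathrm{aLc}}_{b,h}$ = the least size of a set $D\subseteq\prod b$ such that every $\varphi\in\mathcal{S}(b,h)$ anti-localizes some $y\in D$. $\mathfrak{c}=2^{\aleph_0}$. *)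

theory Defs
  imports Complex_Main "HOL-Library.FuncSet" "HOL-Library.Infinite_Set"
begin

unbundle cardinal_syntax

definition slaloms :: "(nat \<Rightarrow> 'a set) \<Rightarrow> (nat \<Rightarrow> nat) \<Rightarrow> (nat \<Rightarrow> 'a set) set" where
  "slaloms b h = Pi\<^sub>E UNIV (\<lambda>n. {s. s \<subseteq> b n \<and> finite s \<and> card s \<le> h n})"

definition anti_localizes :: "(nat \<Rightarrow> 'a set) \<Rightarrow> (nat \<Rightarrow> 'a) \<Rightarrow> bool" where
  "anti_localizes \<phi> y \<longleftrightarrow> (\<forall>\<^sub>\<infinity>n. y n \<notin> \<phi> n)"

text \<open>The least cardinality of a member of a family of sets, as a cardinal order that is
  determined up to \<open>=o\<close>; it is meaningful only for a non-empty family.\<close>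

definition least_size :: "'c set set \<Rightarrow> 'c rel" where
  "least_size \<A> = (SOME r. r \<in> card_of ` \<A> \<and> (\<forall>A\<in>\<A>. r \<le>o |A| ))"

lemma least_size_attained:
  assumes "\<A> \<noteq> {}"
  shows "\<exists>A\<in>\<A>. least_size \<A> = |A| \<and> (\<forall>A'\<in>\<A>. |A| \<le>o |A'| )"
proof -
  have "\<exists>r\<in>card_of ` \<A>. \<forall>r'\<in>card_of ` \<A>. r \<le>o r'"
    using assms by (intro exists_minim_Card_order) (auto simp: card_of_Card_order)
  then have "\<exists>r. r \<in> card_of ` \<A> \<and> (\<forall>A\<in>\<A>. r \<le>o |A| )"
    by blast
  from someI_ex[OF this] show ?thesis
    unfolding least_size_def by auto
qed

definition b_aLc_families :: "(nat \<Rightarrow> 'a set) \<Rightarrow> (nat \<Rightarrow> nat) \<Rightarrow> (nat \<Rightarrow> 'a set) set set" where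
  "b_aLc_families b h =
     {F. F \<subseteq> slaloms b h \<and> \<not> (\<exists>y\<in>Pi\<^sub>E UNIV b. \<forall>\<phi>\<in>F. anti_localizes \<phi> y)}"

definition d_aLc_families :: "(nat \<Rightarrow> 'a set) \<Rightarrow> (nat \<Rightarrow> nat) \<Rightarrow> (nat \<Rightarrow> 'a) set set" where
  "d_aLc_families b h =
     {D. D \<subseteq> Pi\<^sub>E UNIV b \<and> (\<forall>\<phi>\<in>slaloms b h. \<exists>y\<in>D. anti_localizes \<phi> y)}"

definition b_aLc :: "(nat \<Rightarrow> 'a set) \<Rightarrow> (nat \<Rightarrow> nat) \<Rightarrow> (nat \<Rightarrow> 'a set) rel" where
  "b_aLc b h = least_size (b_aLc_families b h)"

definition d_aLc :: "(nat \<Rightarrow> 'a set) \<Rightarrow> (nat \<Rightarrow> nat) \<Rightarrow> (nat \<Rightarrow> 'a) rel" where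
  "d_aLc b h = least_size (d_aLc_families b h)"

lemma b_aLc_families_nonempty:
  assumes "\<And>n. 0 < h n"
  shows "b_aLc_families b h \<noteq> {}"
proof -
  have "\<not> (\<forall>\<phi>\<in>slaloms b h. anti_localizes \<phi> y)" if y: "y \<in> Pi\<^sub>E UNIV b" for y
  proof -
    have "(\<lambda>n. {y n}) \<in> slaloms b h"
      using assms y by (auto simp: slaloms_def PiE_UNIV_domain Suc_le_eq)
    moreover have "\<not> anti_localizes (\<lambda>n. {y n}) y"
      by (simp add: anti_localizes_def)
    ultimately show ?thesis by blast
  qed
  then have "slaloms b h \<in> b_aLc_families b h"
    by (auto simp: b_aLc_families_def)
  then show ?thesis by blast
qed

lemma d_aLc_families_nonempty:
  assumes "\<And>n. finite (b n) \<Longrightarrow> h n < card (b n)"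
  shows "d_aLc_families b h \<noteq> {}"
proof -
  have "\<exists>y\<in>Pi\<^sub>E UNIV b. anti_localizes \<phi> y" if \<phi>: "\<phi> \<in> slaloms b h" for \<phi>
  proof -
    have sub: "\<phi> n \<subseteq> b n" "finite (\<phi> n)" "card (\<phi> n) \<le> h n" for n
      using \<phi> by (auto simp: slaloms_def PiE_UNIV_domain)
    have "\<phi> n \<noteq> b n" for n
      using sub[of n] assms[of n] by auto
    then have "\<exists>x. x \<in> b n \<and> x \<notin> \<phi> n" for n
      using sub(1)[of n] by blast
    then obtain y where "\<And>n. y n \<in> b n \<and> y n \<notin> \<phi> n"
      by metis
    then show ?thesis
      by (intro bexI[of _ y]) (auto simp: anti_localizes_def PiE_UNIV_domain)
  qed
  then have "Pi\<^sub>E UNIV b \<in> d_aLc_families b h"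
    by (auto simp: d_aLc_families_def)
  then show ?thesis by blast
qed

definition size_ratio :: "(nat \<Rightarrow> 'a set) \<Rightarrow> (nat \<Rightarrow> nat) \<Rightarrow> nat \<Rightarrow> real" where
  "size_ratio b h n = (if finite (b n) then real (h n) / real (card (b n)) else 0)"

definition B_set :: "(nat \<Rightarrow> 'a set) \<Rightarrow> (nat \<Rightarrow> nat) \<Rightarrow> nat \<Rightarrow> nat set" where
  "B_set b h N = {n. finite (b n) \<and> card (b n) \<le> N * h n}"

end

theory Submission
  imports Defs "HOL-Library.Countable_Set"
begin

text \<open>
  On an infinite set \<open>B_set b h N\<close> each \<open>b n\<close> splits into \<open>N\<close> pieces of size at most \<open>h n\<close>.
  The \<open>N\<close> slaloms that pick the \<open>i\<close>-th piece everywhere catch every \<open>y\<close> infinitely often,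
  while fewer than \<open>N\<close> slaloms leave room for a common escape at almost every \<open>n\<close> when \<open>N\<close> is least.

  For the second cardinal, there are continuum many colourings of a countable set by \<open>N\<close> colours such
  that any \<open>N\<close> of them take all \<open>N\<close> colours simultaneously infinitely often. The slaloms they
  induce have the property that no \<open>y\<close> is anti-localized by \<open>N\<close> of them, so choosing for each of them
  an anti-localized member of \<open>D\<close> is a finite-to-one map, and \<open>D\<close> has size at least continuum.
  Conversely, shrinking the infinite \<open>b n\<close> to countable subsets yields a witness of size at most
  continuum.
\<close>

section \<open>Small pieces of finite sets and the slaloms they give\<close>

text \<open>Enumerate \<open>A\<close> and cut the enumeration into consecutive blocks of length
  \<open>k\<close>; the colour is the index of the block.\<close>

lemma partition_into_small_pieces:
  assumes "finite A" "card A \<le> N * k" "0 < k"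
  obtains c :: "'a \<Rightarrow> nat"
  where "\<And>x. x \<in> A \<Longrightarrow> c x < N" "\<And>i. card {x \<in> A. c x = i} \<le> k"
proof -
  obtain e where e: "bij_betw e A {0..<card A}"
    using ex_bij_betw_finite_nat[OF assms(1)] by blast
  show ?thesis
  proof (rule that[of "\<lambda>x. e x div k"])
    fix x assume "x \<in> A"
    then have "e x < card A"
      using e by (auto simp: bij_betw_def)
    with assms(2) have "e x < N * k" by linarith
    then show "e x div k < N"
      by (rule less_mult_imp_div_less)
  next
    fix i
    have "e x \<in> {i * k..<i * k + k}" if "e x div k = i" for x
      using that assms(3) dividend_less_div_times[of k "e x"] by (auto simp: add.commute)
    then have "e ` {x \<in> A. e x div k = i} \<subseteq> {i * k..<i * k + k}" by blast
    moreover have "inj_on e {x \<in> A. e x div k = i}"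
      using e by (auto simp: bij_betw_def inj_on_def)
    ultimately have "card {x \<in> A. e x div k = i} \<le> card {i * k..<i * k + k}"
      by (intro card_inj_on_le) auto
    then show "card {x \<in> A. e x div k = i} \<le> k" by simp
  qed
qed

lemma slaloms_iff:
  "\<phi> \<in> slaloms b h \<longleftrightarrow> (\<forall>n. \<phi> n \<subseteq> b n \<and> finite (\<phi> n) \<and> card (\<phi> n) \<le> h n)"
  by (auto simp: slaloms_def PiE_UNIV_domain)

text \<open>A sequence \<open>s\<close> may choose a different piece at each \<open>n\<close>.
  Constant \<open>s\<close> will bound \<open>b_aLc\<close> from above, independent ones will bound
  \<open>d_aLc\<close> from below.\<close>

lemma colouring_of_B_set:
  assumes "\<And>n. 0 < h n"
  obtains c :: "nat \<Rightarrow> 'a \<Rightarrow> nat"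
  where "\<And>n x. n \<in> B_set b h N \<Longrightarrow> x \<in> b n \<Longrightarrow> c n x < N"
    and "\<And>s. (\<lambda>n. if n \<in> B_set b h N then {x \<in> b n. c n x = s n} else {}) \<in> slaloms b h"
proof -
  have "\<exists>c. n \<in> B_set b h N \<longrightarrow> (\<forall>x\<in>b n. c x < N) \<and> (\<forall>i. card {x \<in> b n. c x = i} \<le> h n)" for n
  proof (cases "n \<in> B_set b h N")
    case True
    then have "finite (b n)" "card (b n) \<le> N * h n" by (auto simp: B_set_def)
    then show ?thesis
      by (rule partition_into_small_pieces[OF _ _ assms]) blast
  qed auto
  then obtain c where c: "\<And>n. n \<in> B_set b h N \<longrightarrow>
      (\<forall>x\<in>b n. c n x < N) \<and> (\<forall>i. card {x \<in> b n. c n x = i} \<le> h n)"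
    by metis
  show ?thesis
    by (rule that[of c]) (use c in \<open>auto simp: slaloms_iff B_set_def\<close>)
qed

section \<open>The number \<open>N\<close> and the families for \<open>b_aLc\<close>\<close>

text \<open>Divergence gives an \<open>e > 0\<close> that the ratio reaches infinitely often; any
  \<open>N\<close> above \<open>1 / e\<close> then works.\<close>

lemma infinite_B_set_exists:
  assumes "\<not> (size_ratio b h \<longlonglongrightarrow> 0)"
  shows "\<exists>N. infinite (B_set b h N)"
proof -
  have nonneg: "0 \<le> size_ratio b h n" for n
    by (simp add: size_ratio_def)
  obtain e where e: "e > 0" "\<And>M. \<exists>n\<ge>M. e \<le> size_ratio b h n"
    using assms nonneg by (auto simp: LIMSEQ_iff not_less)
  obtain N where N: "1 / e \<le> real N"
    using real_arch_simple by blast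
  have "n \<in> B_set b h N" if "e \<le> size_ratio b h n" for n
  proof -
    have fin: "finite (b n)" and le: "e \<le> real (h n) / real (card (b n))"
      using that e(1) by (auto simp: size_ratio_def split: if_splits)
    have "e * real (card (b n)) \<le> real (h n)"
      using le e(1) by (cases "card (b n) = 0") (auto simp: field_simps)
    then have "real (card (b n)) \<le> (1 / e) * real (h n)"
      using e(1) by (simp add: field_simps)
    also have "\<dots> \<le> real N * real (h n)"
      using N by (intro mult_right_mono) auto
    finally have "real (card (b n)) \<le> real (N * h n)" by simp
    then show ?thesis
      using fin by (simp only: B_set_def of_nat_le_iff mem_Collect_eq)
  qed
  then have "infinite (B_set b h N)"
    using e(2) unfolding infinite_nat_iff_unbounded_le by blast
  then show ?thesis ..
qed

text \<open>At each \<open>n\<close> the members of \<open>F\<close> cover at most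
  \<open>card F * h n\<close> points together, so outside the finite exceptional set a point of
  \<open>b n\<close> is left for \<open>y\<close>.\<close>

lemma few_slaloms_escaped:
  assumes ne: "\<And>n. b n \<noteq> {}"
    and F: "F \<subseteq> slaloms b h" "finite F" and B: "finite (B_set b h (card F))"
  shows "\<exists>y\<in>Pi\<^sub>E UNIV b. \<forall>\<phi>\<in>F. anti_localizes \<phi> y"
proof -
  have "\<exists>x\<in>b n. n \<notin> B_set b h (card F) \<longrightarrow> (\<forall>\<phi>\<in>F. x \<notin> \<phi> n)" for n
  proof (cases "n \<in> B_set b h (card F)")
    case True
    then show ?thesis using ne[of n] by auto
  next
    case False
    have fin: "finite (\<Union>\<phi>\<in>F. \<phi> n)"
      using F by (auto simp: slaloms_iff subset_iff)
    have "card (\<Union>\<phi>\<in>F. \<phi> n) \<le> (\<Sum>\<phi>\<in>F. card (\<phi> n))"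
      by (rule card_UN_le[OF F(2)])
    also have "\<dots> \<le> card F * h n"
      using F(1) sum_bounded_above[of F "\<lambda>\<phi>. card (\<phi> n)" "h n"] by (auto simp: slaloms_iff subset_iff)
    \<comment> \<open>Outside \<open>B_set\<close>, \<open>b n\<close> is either infinite or finite
      with more than \<open>card F * h n\<close> elements.\<close>
    finally have "\<not> b n \<subseteq> (\<Union>\<phi>\<in>F. \<phi> n)"
      using False fin card_mono[OF fin, of "b n"] finite_subset[OF _ fin, of "b n"]
      by (auto simp: B_set_def)
    then show ?thesis by blast
  qed
  then obtain y where y: "\<And>n. y n \<in> b n"
      "\<And>n. n \<notin> B_set b h (card F) \<Longrightarrow> \<forall>\<phi>\<in>F. y n \<notin> \<phi> n"
    by metis
  have "anti_localizes \<phi> y" if "\<phi> \<in> F" for \<phi>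
  proof -
    have "{n. \<not> y n \<notin> \<phi> n} \<subseteq> B_set b h (card F)"
      using y(2) that by blast
    then show ?thesis
      unfolding anti_localizes_def eventually_cofinite using B finite_subset by blast
  qed
  then show ?thesis
    using y(1) by (intro bexI[of _ y]) (auto simp: PiE_UNIV_domain)
qed

lemma b_aLc_families_small_member:
  assumes "\<And>n. 0 < h n" "infinite (B_set b h N)"
  shows "\<exists>F\<in>b_aLc_families b h. |F| \<le>o |{..<N}|"
proof -
  obtain c :: "nat \<Rightarrow> 'a \<Rightarrow> nat"
    where c: "\<And>n x. n \<in> B_set b h N \<Longrightarrow> x \<in> b n \<Longrightarrow> c n x < N"
      "\<And>s. (\<lambda>n. if n \<in> B_set b h N then {x \<in> b n. c n x = s n} else {}) \<in> slaloms b h"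
    by (rule colouring_of_B_set[where b = b and h = h and N = N, OF assms(1)]) (rule that)
  define \<phi> where "\<phi> i = (\<lambda>n. if n \<in> B_set b h N then {x \<in> b n. c n x = i} else {})" for i
  have "\<not> (\<forall>i<N. anti_localizes (\<phi> i) y)" if y: "y \<in> Pi\<^sub>E UNIV b" for y
  proof
    assume "\<forall>i<N. anti_localizes (\<phi> i) y"
    \<comment> \<open>Only finitely many slaloms are involved, so one threshold serves them
      all.\<close>
    then have "\<forall>\<^sub>\<infinity>n. \<forall>i\<in>{..<N}. y n \<notin> \<phi> i n"
      by (intro eventually_ball_finite) (auto simp: anti_localizes_def)
    then have "\<exists>\<^sub>\<infinity>n. (\<forall>i\<in>{..<N}. y n \<notin> \<phi> i n) \<and> n \<in> B_set b h N"
      using assms(2) by (intro frequently_eventually_conj) (auto simp: frequently_cofinite)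
    then obtain n where n: "n \<in> B_set b h N" "\<forall>i\<in>{..<N}. y n \<notin> \<phi> i n"
      by (auto dest: frequently_ex)
    have "y n \<in> b n" using y by (auto simp: PiE_UNIV_domain)
    with n c(1)[of n "y n"] show False by (auto simp: \<phi>_def)
  qed
  moreover have "\<phi> i \<in> slaloms b h" for i
    using c(2)[of "\<lambda>_. i"] by (simp add: \<phi>_def)
  ultimately have "\<phi> ` {..<N} \<in> b_aLc_families b h"
    by (fastforce simp: b_aLc_families_def)
  then show ?thesis using card_of_image by blast
qed

section \<open>Independent colourings of a countable set\<close>

text \<open>The colouring \<open>s A\<close> reads \<open>l\<close> as a list of candidates for \<open>A \<inter> {..<k}\<close>
  and returns the position of the correct one.\<close>

lemma independent_colourings:
  obtains s :: "nat set \<Rightarrow> (nat \<times> nat list list) \<Rightarrow> nat"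
  where "\<And>\<A>. finite \<A> \<Longrightarrow> infinite {z. {..<card \<A>} \<subseteq> (\<lambda>A. s A z) ` \<A>}"
proof -
  define trace where "trace A k = sorted_list_of_set (A \<inter> {..<k})" for A :: "nat set" and k
  \<comment> \<open>The value is meaningful only when the trace occurs exactly once in the list;
    elsewhere it is arbitrary.\<close>
  define s where "s A z = (THE i. i < length (snd z) \<and> snd z ! i = trace A (fst z))"
    for A :: "nat set" and z :: "nat \<times> nat list list"
  have "infinite {z. {..<card \<A>} \<subseteq> (\<lambda>A. s A z) ` \<A>}" if fin: "finite \<A>" for \<A>
  proof -
    have "\<forall>\<^sub>F k in sequentially. A \<noteq> A' \<longrightarrow> trace A k \<noteq> trace A' k" for A A'
    proof (cases "A = A'")
      case False
      then obtain d where d: "\<not> (d \<in> A \<longleftrightarrow> d \<in> A')" by blast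
      \<comment> \<open>A point \<open>d\<close> of the symmetric difference is seen by both traces
        as soon as \<open>k > d\<close>.\<close>
      have "trace A k \<noteq> trace A' k" if "k \<ge> Suc d" for k
      proof
        assume "trace A k = trace A' k"
        then have "set (trace A k) = set (trace A' k)" by simp
        then have "A \<inter> {..<k} = A' \<inter> {..<k}" by (simp add: trace_def)
        then have "d \<in> A \<inter> {..<k} \<longleftrightarrow> d \<in> A' \<inter> {..<k}" by simp
        then show False using d that by simp
      qed
      then show ?thesis unfolding eventually_sequentially by blast
    qed simp
    then have "\<forall>\<^sub>F k in sequentially. \<forall>A\<in>\<A>. \<forall>A'\<in>\<A>. A \<noteq> A' \<longrightarrow> trace A k \<noteq> trace A' k"
      using fin by (intro eventually_ball_finite ballI)
    then obtain K where K: "\<forall>k\<ge>K. \<forall>A\<in>\<A>. \<forall>A'\<in>\<A>. A \<noteq> A' \<longrightarrow> trace A k \<noteq> trace A' k"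
      unfolding eventually_sequentially ..
    obtain L where L: "set L = \<A>" "distinct L"
      using finite_distinct_list[OF fin] by blast
    \<comment> \<open>The list holds the level \<open>k\<close> traces of all members of \<A>, so
      the \<open>i\<close>-th member receives colour \<open>i\<close> once the traces are
      distinct.\<close>
    define z where "z k = (k, map (\<lambda>A. trace A k) L)" for k
    have "{..<card \<A>} \<subseteq> (\<lambda>A. s A (z k)) ` \<A>" if "k \<ge> K" for k
    proof
      fix i assume "i \<in> {..<card \<A>}"
      then have i: "i < length L" using L distinct_card by fastforce
      have "s (L ! i) (z k) = i"
        unfolding s_def
      proof (rule the_equality)
        fix j assume j: "j < length (snd (z k)) \<and> snd (z k) ! j = trace (L ! i) (fst (z k))"
        then have "j < length L" "trace (L ! j) k = trace (L ! i) k" by (auto simp: z_def)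
        moreover from this have "L ! j = L ! i"
          using K that L(1) i nth_mem by metis
        ultimately show "j = i" using L(2) i nth_eq_iff_index_eq by blast
      qed (use i in \<open>auto simp: z_def\<close>)
      moreover have "L ! i \<in> \<A>" using L(1) i nth_mem by blast
      ultimately show "i \<in> (\<lambda>A. s A (z k)) ` \<A>" by (intro image_eqI[of _ _ "L ! i"]) simp_all
    qed
    then have "z ` {K..} \<subseteq> {z. {..<card \<A>} \<subseteq> (\<lambda>A. s A z) ` \<A>}"
      by (intro image_subsetI) simp
    \<comment> \<open>The first component of \<open>z k\<close> is \<open>k\<close> itself.\<close>
    moreover have "inj z" by (auto simp: z_def inj_def)
    then have "infinite (z ` {K..})"
      using infinite_Ici by (simp add: finite_image_iff inj_on_subset)
    ultimately show ?thesis using finite_subset by blast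
  qed
  then show ?thesis by (rule that)
qed

lemma independent_colourings_on:
  assumes "infinite (B :: nat set)"
  obtains s :: "nat set \<Rightarrow> nat \<Rightarrow> nat"
  where "\<And>\<A>. finite \<A> \<Longrightarrow> infinite {n \<in> B. {..<card \<A>} \<subseteq> (\<lambda>A. s A n) ` \<A>}"
proof -
  obtain s :: "nat set \<Rightarrow> (nat \<times> nat list list) \<Rightarrow> nat"
    where s: "\<And>\<A>. finite \<A> \<Longrightarrow> infinite {z. {..<card \<A>} \<subseteq> (\<lambda>A. s A z) ` \<A>}"
    by (rule independent_colourings) (rule that)
  \<comment> \<open>The countable index type is carried injectively into \<open>B\<close>. Points of
    \<open>B\<close> outside the range get arbitrary colours, which does no harm as the range
    already supplies infinitely many good points.\<close>
  define pos where "pos z = enumerate B (to_nat z)" for z :: "nat \<times> nat list list"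
  have inj: "inj pos"
    unfolding pos_def
    using inj_compose[OF inj_enumerate[OF assms] inj_to_nat] by (simp add: comp_def)
  have pos_in: "pos z \<in> B" for z
    unfolding pos_def by (rule enumerate_in_set[OF assms])
  have "infinite {n \<in> B. {..<card \<A>} \<subseteq> (\<lambda>A. s A (inv pos n)) ` \<A>}" if "finite \<A>" for \<A>
  proof -
    have "pos ` {z. {..<card \<A>} \<subseteq> (\<lambda>A. s A z) ` \<A>}
        \<subseteq> {n \<in> B. {..<card \<A>} \<subseteq> (\<lambda>A. s A (inv pos n)) ` \<A>}"
      by (auto simp only: pos_in inv_f_f[OF inj] image_iff mem_Collect_eq subset_iff)
    moreover have "infinite (pos ` {z. {..<card \<A>} \<subseteq> (\<lambda>A. s A z) ` \<A>})"
      using s[OF that] inj finite_imageD inj_on_subset by blast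
    ultimately show ?thesis using finite_subset by blast
  qed
  then show ?thesis by (rule that)
qed

section \<open>Cardinal bounds and the families for \<open>d_aLc\<close>\<close>

lemma finite_card_of_ordLeq_infinite:
  assumes "finite A" "infinite B"
  shows "|A| \<le>o |B|"
  using assms card_of_ordLeq_finite[of B A]
    ordLeq_total[OF card_of_Well_order[of A] card_of_Well_order[of B]] by blast

text \<open>\<open>A\<close> is a union of finite fibres indexed by \<open>D\<close>. Hence
  \<open>D\<close> is infinite, and such a union has size at most \<open>|D|\<close>.\<close>

lemma card_of_ordLeq_of_finite_fibres:
  assumes "infinite A" "f ` A \<subseteq> D" "\<And>y. y \<in> D \<Longrightarrow> finite {x \<in> A. f x = y}"
  shows "|A| \<le>o |D|"
proof -
  have A: "A = (\<Union>y\<in>D. {x \<in> A. f x = y})" using assms(2) by auto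
  have inf: "infinite D"
    using assms(1,3) A finite_UN_I[of D "\<lambda>y. {x \<in> A. f x = y}"] by auto
  have "|\<Union>y\<in>D. {x \<in> A. f x = y}| \<le>o |D|"
    using assms(3) inf
    by (intro card_of_UNION_ordLeq_infinite ballI finite_card_of_ordLeq_infinite card_of_mono1) auto
  then show ?thesis using A by simp
qed

lemma card_of_nat_sets: "|UNIV :: nat set set| =o ctwo ^c natLeq"
proof -
  have "|Pow (Field natLeq)| =o ctwo ^c natLeq"
    unfolding ctwo_def cexp_def Field_card_of by (rule card_of_Pow_Func)
  then show ?thesis by (simp add: Field_natLeq)
qed

text \<open>If \<open>N\<close> sets of naturals were sent to the same \<open>y\<close>, then
  \<open>y\<close> would avoid their slaloms at almost every \<open>n\<close>, yet at infinitely
  many \<open>n\<close> these slaloms together cover \<open>b n\<close>.\<close>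

lemma continuum_ordLeq_d_aLc_family:
  assumes "\<And>n. 0 < h n" "infinite (B_set b h N)" "D \<in> d_aLc_families b h"
  shows "|UNIV :: nat set set| \<le>o |D|"
proof -
  have D: "D \<subseteq> Pi\<^sub>E UNIV b" "\<And>\<phi>. \<phi> \<in> slaloms b h \<Longrightarrow> \<exists>y\<in>D. anti_localizes \<phi> y"
    using assms(3) by (auto simp: d_aLc_families_def)
  obtain c :: "nat \<Rightarrow> 'a \<Rightarrow> nat"
    where c: "\<And>n x. n \<in> B_set b h N \<Longrightarrow> x \<in> b n \<Longrightarrow> c n x < N"
      "\<And>s. (\<lambda>n. if n \<in> B_set b h N then {x \<in> b n. c n x = s n} else {}) \<in> slaloms b h"
    by (rule colouring_of_B_set[where b = b and h = h and N = N, OF assms(1)]) (rule that)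
  obtain s :: "nat set \<Rightarrow> nat \<Rightarrow> nat" where s: "\<And>\<A>. finite \<A> \<Longrightarrow>
      infinite {n \<in> B_set b h N. {..<card \<A>} \<subseteq> (\<lambda>A. s A n) ` \<A>}"
    by (rule independent_colourings_on[OF assms(2)]) (rule that)
  define \<phi> where
    "\<phi> A = (\<lambda>n. if n \<in> B_set b h N then {x \<in> b n. c n x = s A n} else {})" for A
  have "\<exists>y\<in>D. anti_localizes (\<phi> A) y" for A
    using c(2)[of "s A"] D(2) by (simp add: \<phi>_def)
  then obtain f where f: "\<And>A. f A \<in> D" "\<And>A. anti_localizes (\<phi> A) (f A)" by metis
  have "finite {A. f A = y}" if y: "y \<in> D" for y
  proof (rule ccontr)
    assume "infinite {A. f A = y}"
    then obtain \<A> where \<A>: "\<A> \<subseteq> {A. f A = y}" "finite \<A>" "card \<A> = N"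
      using infinite_arbitrarily_large by blast
    have "\<forall>\<^sub>\<infinity>n. \<forall>A\<in>\<A>. y n \<notin> \<phi> A n"
      using \<A> f(2) by (intro eventually_ball_finite) (auto simp: anti_localizes_def)
    moreover have "\<exists>\<^sub>\<infinity>n. n \<in> B_set b h N \<and> {..<N} \<subseteq> (\<lambda>A. s A n) ` \<A>"
      using s[OF \<A>(2)] unfolding \<A>(3) frequently_cofinite .
    ultimately have "\<exists>\<^sub>\<infinity>n. (\<forall>A\<in>\<A>. y n \<notin> \<phi> A n) \<and>
        (n \<in> B_set b h N \<and> {..<N} \<subseteq> (\<lambda>A. s A n) ` \<A>)"
      by (rule frequently_eventually_conj[rotated])
    then obtain n where n: "\<forall>A\<in>\<A>. y n \<notin> \<phi> A n"
        "n \<in> B_set b h N" "{..<N} \<subseteq> (\<lambda>A. s A n) ` \<A>"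
      by (auto dest: frequently_ex)
    have "y n \<in> b n" using y D(1) by (auto simp: PiE_UNIV_domain)
    moreover from this have "c n (y n) \<in> (\<lambda>A. s A n) ` \<A>"
      using c(1) n(2,3) by blast
    ultimately show False using n(1,2) by (auto simp: \<phi>_def)
  qed
  then show ?thesis
    using f(1) by (intro card_of_ordLeq_of_finite_fibres[of UNIV f]) (auto simp: Finite_Set.finite_set)
qed

lemma card_of_countable_product:
  assumes "\<And>n :: nat. countable (C n)"
  shows "|Pi\<^sub>E UNIV C| \<le>o |UNIV :: nat set set|"
proof -
  \<comment> \<open>\<open>g y\<close> is the graph of \<open>y\<close>, coded as a set of
    naturals.\<close>
  define g where "g y = range (\<lambda>n. prod_encode (n, to_nat_on (C n) (y n)))" for y
  have "inj_on g (Pi\<^sub>E UNIV C)"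
  proof (rule inj_onI, rule ext)
    fix y y' n assume y: "y \<in> Pi\<^sub>E UNIV C" "y' \<in> Pi\<^sub>E UNIV C" and "g y = g y'"
    then have "prod_encode (n, to_nat_on (C n) (y n)) \<in> g y'" by (auto simp: g_def)
    then have "to_nat_on (C n) (y n) = to_nat_on (C n) (y' n)"
      by (auto simp: g_def dest: injD[OF inj_prod_encode])
    moreover have "y n \<in> C n" "y' n \<in> C n"
      using y by (auto simp: PiE_UNIV_domain)
    ultimately show "y n = y' n"
      using assms by simp
  qed
  then show ?thesis using card_of_ordLeq by blast
qed

text \<open>The whole product may exceed the continuum. A countable part of each \<open>b n\<close>
  with more than \<open>h n\<close> elements still cannot be covered by a slalom.\<close>

lemma d_aLc_families_small_member:
  assumes "\<And>n. finite (b n) \<Longrightarrow> h n < card (b n)"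
  shows "\<exists>D\<in>d_aLc_families b h. |D| \<le>o |UNIV :: nat set set|"
proof -
  \<comment> \<open>The bound is asked of finite \<open>C\<close> only, since \<open>card\<close> is
    0 on infinite sets.\<close>
  have "\<exists>C\<subseteq>b n. countable C \<and> (finite C \<longrightarrow> h n < card C)" for n
  proof (cases "finite (b n)")
    case True
    then show ?thesis using assms countable_finite by blast
  next
    case False
    then show ?thesis using infinite_countable_subset'[of "b n"] by blast
  qed
  then obtain C where C: "\<And>n. C n \<subseteq> b n" "\<And>n. countable (C n)"
      "\<And>n. finite (C n) \<Longrightarrow> h n < card (C n)"
    by metis
  have "\<exists>y\<in>Pi\<^sub>E UNIV C. anti_localizes \<phi> y" if \<phi>: "\<phi> \<in> slaloms b h" for \<phi>
  proof -
    have "\<not> C n \<subseteq> \<phi> n" for n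
    proof
      have "finite (\<phi> n)" "card (\<phi> n) \<le> h n"
        using \<phi> by (auto simp: slaloms_iff)
      moreover assume "C n \<subseteq> \<phi> n"
      ultimately show False
        using C(3)[of n] card_mono[of "\<phi> n" "C n"] finite_subset[of "C n" "\<phi> n"] by linarith
    qed
    then have "\<exists>x. x \<in> C n \<and> x \<notin> \<phi> n" for n by blast
    then obtain y where "\<And>n. y n \<in> C n \<and> y n \<notin> \<phi> n" by metis
    then show ?thesis
      by (intro bexI[of _ y]) (auto simp: anti_localizes_def PiE_UNIV_domain)
  qed
  moreover have "Pi\<^sub>E UNIV C \<subseteq> Pi\<^sub>E UNIV b"
    using C(1) by (intro PiE_mono)
  ultimately have "Pi\<^sub>E UNIV C \<in> d_aLc_families b h"
    by (auto simp: d_aLc_families_def)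
  then show ?thesis by (rule bexI[rotated]) (rule card_of_countable_product[of C, OF C(2)])
qed

section \<open>Evaluation of the two cardinals\<close>

lemma least_size_ordIso:
  assumes "A \<in> \<A>" "|A| \<le>o r" "\<And>A'. A' \<in> \<A> \<Longrightarrow> r \<le>o |A'|"
  shows "least_size \<A> =o r"
proof -
  obtain A' where "A' \<in> \<A>" "least_size \<A> = |A'|" "\<forall>A''\<in>\<A>. |A'| \<le>o |A''|"
    using least_size_attained[of \<A>] assms(1) by blast
  then show ?thesis
    using assms ordLeq_transitive by (metis ordIso_iff_ordLeq)
qed

theorem theorem3p13:
  fixes b :: "nat \<Rightarrow> 'a set" and h :: "nat \<Rightarrow> nat"
  assumes "\<And>n. b n \<noteq> {}"
    and "\<And>n. 0 < h n"
    and "\<And>n. finite (b n) \<Longrightarrow> h n < card (b n)"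
    and "\<not> (size_ratio b h \<longlonglongrightarrow> 0)"
  shows "(\<exists>N. infinite (B_set b h N))
    \<and> b_aLc b h =o |{..<(LEAST N. infinite (B_set b h N))}|
    \<and> d_aLc b h =o ctwo ^c natLeq"
proof -
  define N where "N = (LEAST N. infinite (B_set b h N))"
  have ex: "\<exists>N. infinite (B_set b h N)"
    using infinite_B_set_exists[OF assms(4)] .
  then have inf: "infinite (B_set b h N)"
    unfolding N_def by (rule LeastI_ex)
  have lower: "|{..<N}| \<le>o |F|" if F: "F \<in> b_aLc_families b h" for F
  proof (cases "finite F")
    case True
    \<comment> \<open>Otherwise some \<open>y\<close> would escape all of \<open>F\<close>;
      minimality of \<open>N\<close> then gives \<open>N \<le> card F\<close>.\<close>
    have "infinite (B_set b h (card F))"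
      using few_slaloms_escaped[where b = b and h = h and F = F, OF assms(1) _ True] F
      by (force simp: b_aLc_families_def)
    then have "N \<le> card F" unfolding N_def by (rule Least_le)
    then show ?thesis using True
      by (intro card_of_ordLeq[THEN iffD1] inj_on_iff_card_le[THEN iffD2]) auto
  next
    case False
    then show ?thesis by (simp add: finite_card_of_ordLeq_infinite)
  qed
  have "b_aLc b h =o |{..<N}|"
    unfolding b_aLc_def
    using b_aLc_families_small_member[OF assms(2) inf] least_size_ordIso lower by blast
  moreover have "d_aLc b h =o |UNIV :: nat set set|"
    unfolding d_aLc_def
    using d_aLc_families_small_member[where h = h, OF assms(3)] least_size_ordIso
      continuum_ordLeq_d_aLc_family[OF assms(2) inf] by blast
  then have "d_aLc b h =o ctwo ^c natLeq"
    using card_of_nat_sets ordIso_transitive by blast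
  ultimately show ?thesis using ex by (simp add: N_def)
qed

end
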